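(* Let $\Lambda_\infty(\alpha)$ be a nuclear power series space of infinite type, $K(b_{n,k})$ a Köthe space, $\theta=(\theta_t)_{t\ge0}$ a scalar sequence and $s_0=\min\{t:\theta_t\ne0\}$. Then the operator $\check T_\theta:\Lambda_\infty(\alpha)\to K(b_{n,k})$ is well-defined and continuous if and only if $\theta\in(\Lambda_\infty(\alpha))'$ and $$\forall k\in\mathbb{N}\ \exists m\in\mathbb{N},\,C>0\ \ \forall n>s_0:\quad b_{n-s_0,k}\le C e^{m\alpha_n}.$$
   Context: $\mathbb{N}=\{1,2,3,\dots\}$. A Köthe matrix is a matrix $(b_{n,k})_{n,k\in\mathbb{N}}$ of non-negative numbers such that for each $n$ there is $k$ with $b_{n,k}>0$, and $b_{n,k}\le b_{n,k+1}$ for all $n,k$. The Köthe space is $K(b_{n,k})=\{x=(x_n)_{n\in\mathbb{N}}:\|x\|_k:=\sum_n|x_n|b_{n,k}<\infty\ \forall k\in\mathbb{N}\}$, a Fréchet space with the seminorms $\|\cdot\|_k$. For $\alpha=(\alpha_n)_{n\in\mathbb{N}}$ non-negative, increasing, with $\alpha_n\to\infty$, the power series space of infinite type $\Lambda_\infty(\alpha)$ is the Köthe space with matrix $(e^{k\alpha_n})_{n,k}$; it is nuclear iff for every $k$ there is $l>k$ with $\sum_ne^{(k-l)\alpha_n}<\infty$. Its dual is identified with $(\Lambda_\infty(\alpha))'=\{y=(y_n)_{n\in\mathbb{N}}:\sup_n|y_n|e^{-k\alpha_n}<\infty\text{ for some }k\in\mathbb{N}\}$. $e_n$ is the sequence with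 $1$ in the $n$-th place and $0$ elsewhere. For a sequence $\theta=(\theta_0,\theta_1,\theta_2,\dots)$ (regarded as an element of a sequence space indexed by $\mathbb{N}$ by letting its $n$-th coordinate be $\theta_{n-1}$), the operator $\check T_\theta$ given by the upper triangular Toeplitz matrix of $\theta$ is $\check T_\theta e_n=\sum_{j=1}^n\theta_{n-j}e_j$, $\check T_\theta x=\sum_nx_n\check T_\theta e_n$ for $x=\sum_nx_ne_n$; it is well-defined if the series converges in the target space for every $x$ in the domain. Standing assumption: $\theta_t\ne0$ for infinitely many $t$. *)

theory Defs
  imports "HOL-Analysis.Analysis"
begin

text \<open>
  Sequences and matrices are indexed from 0: for a sequence \<open>x n\<close> stands for the coordinate
  with number \<open>n + 1\<close>, and for a matrix \<open>b n k\<close> stands for the entry \<open>(n + 1, k + 1)\<close>.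
  The sequence \<open>\<theta>\<^sub>0, \<theta>\<^sub>1, \<dots>\<close>, whose coordinate with number \<open>n\<close> is by convention
  \<open>\<theta>\<^sub>n\<^sub>-\<^sub>1\<close>, is then just \<open>\<theta>\<close> itself.  Exponents are not shifted.

  The scalar field is any complete real normed field (by Gelfand--Mazur, the reals or the
  complex numbers).
\<close>

definition koethe_matrix :: "(nat \<Rightarrow> nat \<Rightarrow> real) \<Rightarrow> bool" where
  "koethe_matrix b \<longleftrightarrow>
     (\<forall>n k. 0 \<le> b n k) \<and> (\<forall>n. \<exists>k. 0 < b n k) \<and> (\<forall>n k. b n k \<le> b n (Suc k))"

definition koethe_space :: "(nat \<Rightarrow> nat \<Rightarrow> real) \<Rightarrow> (nat \<Rightarrow> 'a::{real_normed_field,banach}) set" where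
  "koethe_space b = {x. \<forall>k. summable (\<lambda>n. norm (x n) * b n k)}"

definition koethe_seminorm ::
    "(nat \<Rightarrow> nat \<Rightarrow> real) \<Rightarrow> nat \<Rightarrow> (nat \<Rightarrow> 'a::{real_normed_field,banach}) \<Rightarrow> real" where
  "koethe_seminorm b k x = (\<Sum>n. norm (x n) * b n k)"

text \<open>The locally convex topology of the seminorms: the open seminorm balls form a subbase.\<close>

definition koethe_topology ::
    "(nat \<Rightarrow> nat \<Rightarrow> real) \<Rightarrow> (nat \<Rightarrow> 'a::{real_normed_field,banach}) topology" where
  "koethe_topology b = topology_generated_by
     {{y \<in> koethe_space b. koethe_seminorm b k (\<lambda>n. y n - x n) < \<epsilon>} | x k \<epsilon>.
        x \<in> koethe_space b \<and> 0 < \<epsilon>}"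

lemma topspace_koethe_topology: "topspace (koethe_topology b) = koethe_space b"
proof -
  have "x \<in> {y \<in> koethe_space b. koethe_seminorm b 0 (\<lambda>n. y n - x n) < 1}"
    if "x \<in> koethe_space b" for x :: "nat \<Rightarrow> 'a"
    using that by (simp add: koethe_seminorm_def)
  moreover have "(0::real) < 1" by simp
  ultimately show ?thesis
    unfolding koethe_topology_def topology_generated_by_topspace by blast
qed

text \<open>The matrix with entries \<open>exp (k * \<alpha>\<^sub>n)\<close>, \<open>k \<ge> 1\<close>, whose Koethe space is
  the power series space of infinite type of \<open>\<alpha>\<close>.\<close>

definition power_series_matrix :: "(nat \<Rightarrow> real) \<Rightarrow> nat \<Rightarrow> nat \<Rightarrow> real" where
  "power_series_matrix \<alpha> n k = exp (real (Suc k) * \<alpha> n)"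

definition exponent_sequence :: "(nat \<Rightarrow> real) \<Rightarrow> bool" where
  "exponent_sequence \<alpha> \<longleftrightarrow>
     (\<forall>n. 0 \<le> \<alpha> n) \<and> incseq \<alpha> \<and> filterlim \<alpha> at_top sequentially"

text \<open>Nuclearity of the power series space, in the Grothendieck--Pietsch form.\<close>

definition nuclear_power_series_space :: "(nat \<Rightarrow> real) \<Rightarrow> bool" where
  "nuclear_power_series_space \<alpha> \<longleftrightarrow>
     (\<forall>k\<ge>1::nat. \<exists>l>k. summable (\<lambda>n. exp ((real k - real l) * \<alpha> n)))"

text \<open>The sequences \<open>y\<close> representing the continuous functionals \<open>x \<mapsto> \<Sum>n. x n * y n\<close>
  on the power series space.\<close>

definition power_series_dual :: "(nat \<Rightarrow> real) \<Rightarrow> (nat \<Rightarrow> 'a::{real_normed_field,banach}) set" where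
  "power_series_dual \<alpha> =
     {y. \<exists>k\<ge>1::nat. bdd_above (range (\<lambda>n. norm (y n) * exp (- real k * \<alpha> n)))}"

definition unit_seq :: "nat \<Rightarrow> nat \<Rightarrow> 'a::{real_normed_field,banach}" where
  "unit_seq n = (\<lambda>i. if i = n then 1 else 0)"

definition toeplitz_column :: "(nat \<Rightarrow> 'a) \<Rightarrow> nat \<Rightarrow> nat \<Rightarrow> 'a::{real_normed_field,banach}" where
  "toeplitz_column \<theta> n = (\<lambda>i. \<Sum>j\<le>n. \<theta> (n - j) * unit_seq j i)"

definition toeplitz_sums ::
    "(nat \<Rightarrow> nat \<Rightarrow> real) \<Rightarrow> (nat \<Rightarrow> 'a) \<Rightarrow> (nat \<Rightarrow> 'a) \<Rightarrow>
       (nat \<Rightarrow> 'a::{real_normed_field,banach}) \<Rightarrow> bool" where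
  "toeplitz_sums b \<theta> x y \<longleftrightarrow>
     limitin (koethe_topology b) (\<lambda>N i. \<Sum>n<N. x n * toeplitz_column \<theta> n i) y sequentially"

definition toeplitz_well_defined ::
    "(nat \<Rightarrow> real) \<Rightarrow> (nat \<Rightarrow> nat \<Rightarrow> real) \<Rightarrow> (nat \<Rightarrow> 'a::{real_normed_field,banach}) \<Rightarrow> bool" where
  "toeplitz_well_defined \<alpha> b \<theta> \<longleftrightarrow>
     (\<forall>x \<in> koethe_space (power_series_matrix \<alpha>). \<exists>y. toeplitz_sums b \<theta> x y)"

text \<open>The limit is unique, because for a Koethe matrix \<open>b\<close> the topology is Hausdorff.\<close>

definition toeplitz_operator ::
    "(nat \<Rightarrow> nat \<Rightarrow> real) \<Rightarrow> (nat \<Rightarrow> 'a) \<Rightarrow> (nat \<Rightarrow> 'a) \<Rightarrow>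
       (nat \<Rightarrow> 'a::{real_normed_field,banach})" where
  "toeplitz_operator b \<theta> x = (THE y. toeplitz_sums b \<theta> x y)"

end

theory Submission
  imports Defs
begin

text \<open>
  Write \<open>T\<close> for the Toeplitz operator, and let the columns of its matrix be the images of the unit
  sequences.  The unit sequences have seminorms \<open>exp (m * \<alpha> n)\<close> in the power series space,
  and the seminorms there are weighted \<open>l\<^sup>1\<close>-norms.  This reduces everything to the columns:
  \<open>T\<close> is well-defined and continuous iff each seminorm of the column number \<open>n\<close> is bounded
  by a constant times some \<open>exp (m * \<alpha> n)\<close>.  One direction tests continuity at the origin on
  multiples of the unit sequences (\<open>toeplitz_column_bound_if_continuous\<close>).  In the other one, the
  series defining \<open>T x\<close> converges absolutely, and its sum obeys the triangle inequality
  (\<open>koethe_suminf\<close>, \<open>toeplitz_continuous_if_column_bound\<close>).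

  The seminorm of the column number \<open>n\<close> is the sum of \<open>norm (\<theta> (n - i)) * b i k\<close> over
  \<open>i \<le> n\<close>.  If it is bounded as above, then so is each summand.  The summand \<open>i = 0\<close>, for
  a \<open>k\<close> with \<open>b 0 k > 0\<close>, shows that \<open>\<theta>\<close> lies in the dual, and the summand \<open>i = n - s\<^sub>0\<close> gives the growth condition
  on \<open>b\<close>.  Conversely, the summands with \<open>n - i < s\<^sub>0\<close> vanish, and in the others the two
  factors are bounded by constants times \<open>exp (p * \<alpha> n)\<close> and \<open>exp (m * \<alpha> n)\<close>, because
  \<open>\<alpha>\<close> increases.  This leaves a factor \<open>n + 1\<close> for the number of summands, which nuclearity
  absorbs into a further power of \<open>exp (\<alpha> n)\<close> (\<open>nuclear_index_growth\<close>).
\<close>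


section \<open>The seminorms of a Koethe space\<close>

lemma koethe_matrix_nonneg: "koethe_matrix b \<Longrightarrow> 0 \<le> b n k"
  by (simp add: koethe_matrix_def)

lemma koethe_matrix_mono:
  assumes "koethe_matrix b" "k \<le> l"
  shows "b n k \<le> b n l"
  using assms by (auto simp: koethe_matrix_def intro: lift_Suc_mono_le[of "b n"])

lemma koethe_matrix_power_series_matrix:
  assumes "\<And>n. 0 \<le> \<alpha> n"
  shows "koethe_matrix (power_series_matrix \<alpha>)"
  using assms by (auto simp: koethe_matrix_def power_series_matrix_def intro!: mult_right_mono)

lemma koethe_spaceD: "x \<in> koethe_space b \<Longrightarrow> summable (\<lambda>n. norm (x n) * b n k)"
  by (simp add: koethe_space_def)

lemma finite_support_in_koethe_space:
  assumes "\<And>n. n \<notin> A \<Longrightarrow> x n = 0" "finite A"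
  shows "x \<in> koethe_space b"
  unfolding koethe_space_def using assms
  by (auto intro!: summable_finite[of A])

lemma koethe_seminorm_finite_support:
  assumes "\<And>n. n \<notin> A \<Longrightarrow> x n = 0" "finite A"
  shows "koethe_seminorm b k x = (\<Sum>n\<in>A. norm (x n) * b n k)"
  unfolding koethe_seminorm_def using assms by (intro suminf_finite) auto

lemma koethe_seminorm_zero [simp]: "koethe_seminorm b k (\<lambda>n. 0) = 0"
  by (simp add: koethe_seminorm_def)

lemma koethe_space_scale:
  assumes "x \<in> koethe_space b"
  shows "(\<lambda>n. c * x n) \<in> koethe_space b"
  unfolding koethe_space_def
  using summable_mult[OF koethe_spaceD[OF assms], of "norm c"]
  by (simp add: norm_mult mult.assoc)

lemma koethe_seminorm_scale:
  assumes "x \<in> koethe_space b"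
  shows "koethe_seminorm b k (\<lambda>n. c * x n) = norm c * koethe_seminorm b k x"
  unfolding koethe_seminorm_def
  by (simp add: norm_mult mult.assoc suminf_mult[OF koethe_spaceD[OF assms]])

lemma koethe_space_diff:
  assumes "koethe_matrix b" "x \<in> koethe_space b" "y \<in> koethe_space b"
  shows "(\<lambda>n. x n - y n) \<in> koethe_space b"
  unfolding koethe_space_def
proof safe
  fix k
  show "summable (\<lambda>n. norm (x n - y n) * b n k)"
  proof (rule summable_comparison_test')
    show "summable (\<lambda>n. norm (x n) * b n k + norm (y n) * b n k)"
      by (intro summable_add koethe_spaceD assms)
    show "norm (norm (x n - y n) * b n k) \<le> norm (x n) * b n k + norm (y n) * b n k" for n
      using mult_right_mono[OF norm_triangle_ineq4 koethe_matrix_nonneg[OF assms(1)], of "x n" "y n" n k]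
        koethe_matrix_nonneg[OF assms(1)]
      by (simp add: distrib_right)
  qed
qed

lemma koethe_seminorm_minus_commute:
  "koethe_seminorm b k (\<lambda>n. x n - y n) = koethe_seminorm b k (\<lambda>n. y n - x n)"
  by (simp add: koethe_seminorm_def norm_minus_commute)

lemma koethe_seminorm_triangle:
  assumes "koethe_matrix b" "x \<in> koethe_space b" "y \<in> koethe_space b" "z \<in> koethe_space b"
  shows "koethe_seminorm b k (\<lambda>n. x n - z n)
           \<le> koethe_seminorm b k (\<lambda>n. x n - y n) + koethe_seminorm b k (\<lambda>n. y n - z n)"
proof -
  note s = koethe_spaceD[OF koethe_space_diff[OF assms(1)]]
  have "norm (x n - z n) * b n k \<le> norm (x n - y n) * b n k + norm (y n - z n) * b n k" for n
    using mult_right_mono[OF norm_triangle_ineq koethe_matrix_nonneg[OF assms(1)],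
        of "x n - y n" "y n - z n" n k]
    by (simp add: distrib_right)
  then have "koethe_seminorm b k (\<lambda>n. x n - z n)
      \<le> (\<Sum>n. norm (x n - y n) * b n k + norm (y n - z n) * b n k)"
    unfolding koethe_seminorm_def
    by (intro suminf_le summable_add s assms)
  then show ?thesis
    unfolding koethe_seminorm_def by (simp add: suminf_add s assms)
qed

lemma koethe_seminorm_mono:
  assumes "koethe_matrix b" "x \<in> koethe_space b" "k \<le> l"
  shows "koethe_seminorm b k x \<le> koethe_seminorm b l x"
  unfolding koethe_seminorm_def
  by (intro suminf_le mult_left_mono koethe_matrix_mono koethe_spaceD assms norm_ge_zero)

lemma coordinate_le_koethe_seminorm:
  assumes "koethe_matrix b" "x \<in> koethe_space b"
  shows "norm (x i) * b i k \<le> koethe_seminorm b k x"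
  using sum_le_suminf[OF koethe_spaceD[OF assms(2)], of "{i}" k] koethe_matrix_nonneg[OF assms(1)]
  by (simp add: koethe_seminorm_def)

lemma koethe_space_eqI:
  assumes "koethe_matrix b" "x \<in> koethe_space b" "y \<in> koethe_space b"
    and "\<And>k. koethe_seminorm b k (\<lambda>n. x n - y n) \<le> 0"
  shows "x = y"
proof
  fix i
  obtain k where k: "0 < b i k"
    using assms(1) unfolding koethe_matrix_def by blast
  have "norm (x i - y i) * b i k \<le> 0"
    using coordinate_le_koethe_seminorm[OF assms(1) koethe_space_diff[OF assms(1-3)], of i k] assms(4)[of k]
    by linarith
  then show "x i = y i"
    using k by (simp add: mult_le_0_iff)
qed


section \<open>The topology of a Koethe space\<close>

lemma openin_koethe_ball:
  assumes "x \<in> koethe_space b" "0 < \<epsilon>"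
  shows "openin (koethe_topology b) {y \<in> koethe_space b. koethe_seminorm b k (\<lambda>n. y n - x n) < \<epsilon>}"
  unfolding koethe_topology_def using assms by (intro topology_generated_by_Basis) blast

text \<open>The seminorms increase with \<open>k\<close>, so finitely many of them are dominated by a single one.
  Hence the balls of single seminorms, which a priori only form a subbase, contain a base of
  neighbourhoods of each point.\<close>

lemma openin_koethe_contains_ball:
  fixes x :: "nat \<Rightarrow> 'a::{real_normed_field,banach}"
  assumes b: "koethe_matrix b" and "openin (koethe_topology b) U" "x \<in> U"
  shows "\<exists>k. \<exists>\<epsilon>>0. {y \<in> koethe_space b. koethe_seminorm b k (\<lambda>n. y n - x n) < \<epsilon>} \<subseteq> U"
proof -
  define S where "S = {{y \<in> koethe_space b. koethe_seminorm b k (\<lambda>n. y n - z n) < \<epsilon>} | (z :: nat \<Rightarrow> 'a) k \<epsilon>.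
        z \<in> koethe_space b \<and> 0 < \<epsilon>}"
  have xK: "x \<in> koethe_space b"
    using openin_subset[OF assms(2)] assms(3) by (auto simp: topspace_koethe_topology)
  have "generate_topology_on S U"
    using assms(2) unfolding koethe_topology_def S_def by (rule openin_topology_generated_by)
  then show ?thesis
    using assms(3)
  proof induction
    case Empty
    then show ?case by simp
  next
    case (Int V W)
    then obtain k \<epsilon> l \<delta> where
      V: "\<epsilon> > 0" "{y \<in> koethe_space b. koethe_seminorm b k (\<lambda>n. y n - x n) < \<epsilon>} \<subseteq> V" and
      W: "\<delta> > 0" "{y \<in> koethe_space b. koethe_seminorm b l (\<lambda>n. y n - x n) < \<delta>} \<subseteq> W"
      by blast
    have "{y \<in> koethe_space b. koethe_seminorm b (max k l) (\<lambda>n. y n - x n) < min \<epsilon> \<delta>} \<subseteq> V \<inter> W"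
    proof safe
      fix y assume y: "y \<in> koethe_space b" "koethe_seminorm b (max k l) (\<lambda>n. y n - x n) < min \<epsilon> \<delta>"
      note mono = koethe_seminorm_mono[OF b koethe_space_diff[OF b y(1) xK]]
      show "y \<in> V"
        using V(2) y mono[of k "max k l"] by auto
      show "y \<in> W"
        using W(2) y mono[of l "max k l"] by auto
    qed
    moreover have "min \<epsilon> \<delta> > 0"
      using V W by simp
    ultimately show ?case by blast
  next
    case (UN \<V>)
    then obtain V where "V \<in> \<V>" "x \<in> V" by blast
    with UN.IH[of V] show ?case by blast
  next
    case (Basis B)
    then obtain z k \<epsilon> where B: "B = {y \<in> koethe_space b. koethe_seminorm b k (\<lambda>n. y n - z n) < \<epsilon>}"
      and z: "z \<in> koethe_space b"
      unfolding S_def by blast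
    let ?\<delta> = "\<epsilon> - koethe_seminorm b k (\<lambda>n. x n - z n)"
    have "{y \<in> koethe_space b. koethe_seminorm b k (\<lambda>n. y n - x n) < ?\<delta>} \<subseteq> B"
      unfolding B using koethe_seminorm_triangle[OF b _ xK z, of _ k] by fastforce
    moreover have "?\<delta> > 0"
      using Basis.prems B by simp
    ultimately show ?case by blast
  qed
qed

lemma limitin_koethe_topology:
  assumes b: "koethe_matrix b"
  shows "limitin (koethe_topology b) f y F \<longleftrightarrow>
    y \<in> koethe_space b \<and>
    (\<forall>k. \<forall>\<epsilon>>0. \<forall>\<^sub>F N in F. f N \<in> koethe_space b \<and> koethe_seminorm b k (\<lambda>n. f N n - y n) < \<epsilon>)"
    (is "?L \<longleftrightarrow> ?R")
proof
  assume L: ?L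
  then have y: "y \<in> koethe_space b"
    by (simp add: limitin_def topspace_koethe_topology)
  have "\<forall>\<^sub>F N in F. f N \<in> {z \<in> koethe_space b. koethe_seminorm b k (\<lambda>n. z n - y n) < \<epsilon>}"
    if "\<epsilon> > 0" for k \<epsilon>
    using L y that unfolding limitin_def
    by (auto dest!: spec[of _ "{z \<in> koethe_space b. koethe_seminorm b k (\<lambda>n. z n - y n) < \<epsilon>}"]
        intro: openin_koethe_ball)
  with y show ?R by simp
next
  assume R: ?R
  show ?L
    unfolding limitin_def topspace_koethe_topology
  proof (intro conjI allI impI)
    show "y \<in> koethe_space b" using R by blast
    fix U assume "openin (koethe_topology b) U \<and> y \<in> U"
    then obtain k \<epsilon> where U: "\<epsilon> > 0" "{z \<in> koethe_space b. koethe_seminorm b k (\<lambda>n. z n - y n) < \<epsilon>} \<subseteq> U"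
      using openin_koethe_contains_ball[OF b] by blast
    with R have "\<forall>\<^sub>F N in F. f N \<in> koethe_space b \<and> koethe_seminorm b k (\<lambda>n. f N n - y n) < \<epsilon>"
      by blast
    then show "\<forall>\<^sub>F N in F. f N \<in> U"
      by (rule eventually_mono) (use U in blast)
  qed
qed

lemma limitin_koethe_topology_unique:
  assumes b: "koethe_matrix b" and "F \<noteq> bot"
    and y: "limitin (koethe_topology b) f y F" and z: "limitin (koethe_topology b) f z F"
  shows "y = z"
proof (rule koethe_space_eqI[OF b])
  show yz: "y \<in> koethe_space b" "z \<in> koethe_space b"
    using y z by (auto simp: limitin_koethe_topology[OF b])
  show "koethe_seminorm b k (\<lambda>n. y n - z n) \<le> 0" for k
  proof (rule field_le_epsilon)
    fix e :: real assume "0 < e"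
    then have "0 < e / 2" by simp
    then have "\<forall>\<^sub>F N in F. f N \<in> koethe_space b \<and> koethe_seminorm b k (\<lambda>n. f N n - y n) < e / 2"
      "\<forall>\<^sub>F N in F. f N \<in> koethe_space b \<and> koethe_seminorm b k (\<lambda>n. f N n - z n) < e / 2"
      using y z unfolding limitin_koethe_topology[OF b] by blast+
    then have "\<forall>\<^sub>F N in F. koethe_seminorm b k (\<lambda>n. y n - z n) \<le> 0 + e"
    proof eventually_elim
      case (elim N)
      then show ?case
        using koethe_seminorm_triangle[OF b yz(1) _ yz(2), of "f N" k]
          koethe_seminorm_minus_commute[of b k y "f N"] by simp
    qed
    then show "koethe_seminorm b k (\<lambda>n. y n - z n) \<le> 0 + e"
      using \<open>F \<noteq> bot\<close> by (simp add: eventually_const)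
  qed
qed

lemma continuous_map_koethe_topologyI:
  fixes f :: "(nat \<Rightarrow> 'a::{real_normed_field,banach}) \<Rightarrow> nat \<Rightarrow> 'b::{real_normed_field,banach}"
  assumes a: "koethe_matrix a"
    and b: "koethe_matrix b"
    and maps: "\<And>x. x \<in> koethe_space a \<Longrightarrow> f x \<in> koethe_space b"
    and bound: "\<And>k. \<exists>m C. \<forall>x\<in>koethe_space a. \<forall>y\<in>koethe_space a.
      koethe_seminorm b k (\<lambda>n. f x n - f y n) \<le> C * koethe_seminorm a m (\<lambda>n. x n - y n)"
  shows "continuous_map (koethe_topology a) (koethe_topology b) f"
  unfolding continuous_map_def topspace_koethe_topology
proof (intro conjI allI impI)
  show "f \<in> koethe_space a \<rightarrow> koethe_space b" using maps by blast
  fix U :: "(nat \<Rightarrow> 'b) set" assume U: "openin (koethe_topology b) U"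
  show "openin (koethe_topology a) {x \<in> koethe_space a. f x \<in> U}"
  proof (subst openin_subopen, safe)
    fix x assume x: "x \<in> koethe_space a" "f x \<in> U"
    obtain k \<epsilon> where \<epsilon>: "\<epsilon> > 0" "{z \<in> koethe_space b. koethe_seminorm b k (\<lambda>n. z n - f x n) < \<epsilon>} \<subseteq> U"
      using openin_koethe_contains_ball[OF b U x(2)] by blast
    obtain m C where C: "\<And>x y. x \<in> koethe_space a \<Longrightarrow> y \<in> koethe_space a \<Longrightarrow>
        koethe_seminorm b k (\<lambda>n. f x n - f y n) \<le> C * koethe_seminorm a m (\<lambda>n. x n - y n)"
      using bound[of k] by blast
    let ?B = "{y \<in> koethe_space a. koethe_seminorm a m (\<lambda>n. y n - x n) < \<epsilon> / (\<bar>C\<bar> + 1)}"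
    have "f y \<in> U" if y: "y \<in> ?B" for y
    proof -
      have yK: "y \<in> koethe_space a" using y by simp
      have nn: "0 \<le> koethe_seminorm a m (\<lambda>n. y n - x n)"
        using koethe_matrix_nonneg[OF a] koethe_spaceD[OF koethe_space_diff[OF a yK x(1)]]
        by (auto simp: koethe_seminorm_def intro!: suminf_nonneg)
      have "koethe_seminorm b k (\<lambda>n. f y n - f x n) \<le> C * koethe_seminorm a m (\<lambda>n. y n - x n)"
        using C yK x(1) .
      also have "\<dots> \<le> (\<bar>C\<bar> + 1) * koethe_seminorm a m (\<lambda>n. y n - x n)"
        by (intro mult_right_mono nn) simp
      also have "\<dots> < \<epsilon>"
        using y by (simp add: pos_less_divide_eq mult.commute add_nonneg_pos)
      finally show ?thesis
        using \<epsilon>(2) maps[OF yK] by blast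
    qed
    moreover have "openin (koethe_topology a) ?B"
      using \<epsilon>(1) x(1) by (intro openin_koethe_ball) (auto simp: add_nonneg_pos)
    moreover have "x \<in> ?B"
      using \<epsilon>(1) x(1) by (auto simp: add_nonneg_pos)
    ultimately show "\<exists>T. openin (koethe_topology a) T \<and> x \<in> T \<and> T \<subseteq> {x \<in> koethe_space a. f x \<in> U}"
      by (intro exI[of _ ?B]) auto
  qed
qed


section \<open>Absolutely convergent series in a Koethe space\<close>

text \<open>If \<open>b i k > 0\<close>, then \<open>norm (v n i) \<le> koethe_seminorm b k (v n) / b i k\<close>, so each coordinate
  of an absolutely convergent series converges absolutely.\<close>

lemma summable_coordinate:
  assumes b: "koethe_matrix b" and v: "\<And>n. v n \<in> koethe_space b"
    and sum: "\<And>k. summable (\<lambda>n. koethe_seminorm b k (v n))"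
  shows "summable (\<lambda>n. norm (v n i))"
proof -
  obtain k where k: "0 < b i k"
    using b unfolding koethe_matrix_def by blast
  have "summable (\<lambda>n. koethe_seminorm b k (v n) / b i k)"
    by (intro summable_divide sum)
  then show ?thesis
    by (rule summable_comparison_test')
      (use k coordinate_le_koethe_seminorm[OF b v] in \<open>auto simp: field_simps\<close>)
qed

text \<open>The triangle inequality for infinite sums.  The partial sums of the double series are bounded
  by exchanging a finite sum with an infinite one, so no exchange of two infinite sums occurs.\<close>

lemma koethe_suminf:
  fixes v :: "nat \<Rightarrow> nat \<Rightarrow> 'a::{real_normed_field,banach}"
  assumes b: "koethe_matrix b" and v: "\<And>n. v n \<in> koethe_space b"
    and sum: "\<And>k. summable (\<lambda>n. koethe_seminorm b k (v n))"
  shows "(\<lambda>i. \<Sum>n. v n i) \<in> koethe_space b"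
    and "koethe_seminorm b k (\<lambda>i. \<Sum>n. v n i) \<le> (\<Sum>n. koethe_seminorm b k (v n))"
proof -
  note c = summable_coordinate[OF b v sum]
  have partial: "(\<Sum>i<I. norm (\<Sum>n. v n i) * b i k) \<le> (\<Sum>n. koethe_seminorm b k (v n))" for I k
  proof -
    have "(\<Sum>i<I. norm (\<Sum>n. v n i) * b i k) \<le> (\<Sum>i<I. (\<Sum>n. norm (v n i) * b i k))"
      by (intro sum_mono)
        (simp add: suminf_mult2[OF c, symmetric] mult_right_mono summable_norm c koethe_matrix_nonneg b)
    also have "\<dots> = (\<Sum>n. \<Sum>i<I. norm (v n i) * b i k)"
      by (intro suminf_sum[symmetric] summable_mult2 c)
    also have "\<dots> \<le> (\<Sum>n. koethe_seminorm b k (v n))"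
    proof (intro suminf_le summable_sum summable_mult2 c sum)
      show "(\<Sum>i<I. norm (v n i) * b i k) \<le> koethe_seminorm b k (v n)" for n
        unfolding koethe_seminorm_def
        by (intro sum_le_suminf koethe_spaceD v) (auto simp: koethe_matrix_nonneg b)
    qed
    finally show ?thesis .
  qed
  have summ: "summable (\<lambda>i. norm (\<Sum>n. v n i) * b i k)" for k
    by (rule summableI_nonneg_bounded[OF _ partial]) (simp add: koethe_matrix_nonneg b)
  then show "(\<lambda>i. \<Sum>n. v n i) \<in> koethe_space b"
    by (simp add: koethe_space_def)
  show "koethe_seminorm b k (\<lambda>i. \<Sum>n. v n i) \<le> (\<Sum>n. koethe_seminorm b k (v n))"
    unfolding koethe_seminorm_def[of b k "\<lambda>i. \<Sum>n. v n i"]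
    by (rule suminf_le_const[OF summ partial])
qed

text \<open>The difference between the sum and a partial sum is the sum of the remaining terms, so the
  triangle inequality bounds its seminorms by the tails of convergent series.\<close>

lemma koethe_series_limit:
  fixes v :: "nat \<Rightarrow> nat \<Rightarrow> 'a::{real_normed_field,banach}"
  assumes b: "koethe_matrix b" and v: "\<And>n. v n \<in> koethe_space b"
    and sum: "\<And>k. summable (\<lambda>n. koethe_seminorm b k (v n))"
  shows "limitin (koethe_topology b) (\<lambda>N i. \<Sum>n<N. v n i) (\<lambda>i. \<Sum>n. v n i) sequentially"
  unfolding limitin_koethe_topology[OF b]
proof (intro conjI allI impI)
  let ?y = "\<lambda>i. \<Sum>n. v n i"
  show y: "?y \<in> koethe_space b"
    by (rule koethe_suminf[OF b v sum])
  fix k and \<epsilon> :: real assume "0 < \<epsilon>"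
  have tail: "?y i - (\<Sum>n<N. v n i) = (\<Sum>n. v (n + N) i)" for N i
    using suminf_split_initial_segment[OF summable_norm_cancel[OF summable_coordinate[OF b v sum]], of i N]
    by simp
  note shift = koethe_suminf[OF b, of "\<lambda>n. v (n + N)" for N,
      OF v summable_ignore_initial_segment[OF sum]]
  have "(\<lambda>i. \<Sum>n<N. v n i) \<in> koethe_space b" for N
    using koethe_space_diff[OF b y shift(1)[of N]] by (simp flip: tail)
  moreover have "koethe_seminorm b k (\<lambda>i. (\<Sum>n<N. v n i) - ?y i)
      \<le> (\<Sum>n. koethe_seminorm b k (v (n + N)))" for N
    using shift(2)[of k N] by (simp add: koethe_seminorm_minus_commute[of b k _ ?y] tail)
  moreover have "\<forall>\<^sub>F N in sequentially. (\<Sum>n. koethe_seminorm b k (v (n + N))) < \<epsilon>"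
    using order_tendstoD(2)[OF suminf_exist_split2[OF sum] \<open>0 < \<epsilon>\<close>] .
  ultimately show "\<forall>\<^sub>F N in sequentially. (\<lambda>i. \<Sum>n<N. v n i) \<in> koethe_space b \<and>
      koethe_seminorm b k (\<lambda>i. (\<Sum>n<N. v n i) - ?y i) < \<epsilon>"
    by (auto elim!: eventually_mono intro: order.strict_trans1)
qed


section \<open>Toeplitz operators\<close>

lemma toeplitz_column_eq: "toeplitz_column \<theta> n i = (if i \<le> n then \<theta> (n - i) else 0)"
  by (simp add: toeplitz_column_def unit_seq_def if_distrib[of "\<lambda>c. _ * c"] sum.delta cong: if_cong)

lemma toeplitz_column_in_koethe_space: "toeplitz_column \<theta> n \<in> koethe_space b"
  by (rule finite_support_in_koethe_space[of "{..n}"]) (auto simp: toeplitz_column_eq)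

lemma koethe_seminorm_toeplitz_column:
  "koethe_seminorm b k (toeplitz_column \<theta> n) = (\<Sum>i\<le>n. norm (\<theta> (n - i)) * b i k)"
  by (subst koethe_seminorm_finite_support[of "{..n}"]) (auto simp: toeplitz_column_eq)

lemma toeplitz_operator_eqI:
  assumes "koethe_matrix b" "toeplitz_sums b \<theta> x y"
  shows "toeplitz_operator b \<theta> x = y"
  unfolding toeplitz_operator_def
  using assms limitin_koethe_topology_unique[OF assms(1) sequentially_bot]
  by (intro the_equality) (auto simp: toeplitz_sums_def)

lemma toeplitz_operator_scaled_unit_seq:
  fixes \<theta> :: "nat \<Rightarrow> 'a::{real_normed_field,banach}"
  assumes b: "koethe_matrix b"
  shows "toeplitz_operator b \<theta> (\<lambda>i. c * unit_seq n i) = (\<lambda>i. c * toeplitz_column \<theta> n i)"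
proof (rule toeplitz_operator_eqI[OF b])
  have "\<forall>\<^sub>F N in sequentially. (\<lambda>i. \<Sum>m<N. c * unit_seq n m * toeplitz_column \<theta> m i)
      = (\<lambda>i. c * toeplitz_column \<theta> n i)"
    using eventually_gt_at_top[of n]
    by eventually_elim
      (auto simp: unit_seq_def if_distrib[of "\<lambda>d. c * d * _"] sum.delta cong: if_cong)
  then show "toeplitz_sums b \<theta> (\<lambda>i. c * unit_seq n i) (\<lambda>i. c * toeplitz_column \<theta> n i)"
    unfolding toeplitz_sums_def
    by (intro limitin_eventually)
      (simp_all add: topspace_koethe_topology koethe_space_scale toeplitz_column_in_koethe_space)
qed

text \<open>Continuity at the origin gives a ball of the seminorm with number \<open>m\<close> that is mapped into the
  unit ball of the seminorm with number \<open>k\<close>; a multiple of the unit sequence scaled into that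
  ball yields the bound.\<close>

lemma toeplitz_column_bound_if_continuous:
  fixes \<theta> :: "nat \<Rightarrow> 'a::{real_normed_field,banach}"
  assumes a: "koethe_matrix a" and apos: "\<And>n k. 0 < a n k" and b: "koethe_matrix b"
    and cont: "continuous_map (koethe_topology a) (koethe_topology b) (toeplitz_operator b \<theta>)"
  shows "\<exists>m. \<exists>C>0. \<forall>n. koethe_seminorm b k (toeplitz_column \<theta> n) \<le> C * a n m"
proof -
  have zeroa: "(\<lambda>n. 0) \<in> koethe_space a" and zerob: "(\<lambda>n. 0) \<in> koethe_space b"
    by (auto simp: koethe_space_def)
  let ?B = "{y \<in> koethe_space b. koethe_seminorm b k (\<lambda>n. y n - 0) < 1}"
  let ?V = "{x \<in> topspace (koethe_topology a). toeplitz_operator b \<theta> x \<in> ?B}"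
  have V: "openin (koethe_topology a) ?V"
    by (rule openin_continuous_map_preimage[OF cont openin_koethe_ball[OF zerob]]) simp
  have "toeplitz_operator b \<theta> (\<lambda>i. 0) = (\<lambda>i. 0)"
    using toeplitz_operator_scaled_unit_seq[OF b, of \<theta> 0] by simp
  then have "(\<lambda>n. 0) \<in> ?V"
    using zeroa zerob by (simp add: topspace_koethe_topology)
  from openin_koethe_contains_ball[OF a V this] obtain m \<epsilon> where \<epsilon>: "\<epsilon> > 0"
    "{x \<in> koethe_space a. koethe_seminorm a m (\<lambda>n. x n - 0) < \<epsilon>} \<subseteq> ?V"
    by blast
  have "koethe_seminorm b k (toeplitz_column \<theta> n) \<le> (2 / \<epsilon>) * a n m" for n
  proof -
    \<comment> \<open>The factor \<open>2\<close> puts the scaled unit sequence strictly inside the ball.\<close>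
    define r where "r = \<epsilon> / (2 * a n m)"
    have r: "r > 0"
      using \<epsilon>(1) apos by (simp add: r_def)
    define x :: "nat \<Rightarrow> 'a" where "x = (\<lambda>i. of_real r * unit_seq n i)"
    have supp: "i \<notin> {n} \<Longrightarrow> x i = 0" for i
      by (simp add: x_def unit_seq_def)
    have xK: "x \<in> koethe_space a"
      by (rule finite_support_in_koethe_space[of "{n}"]) (simp_all add: supp)
    have "koethe_seminorm a m x = r * a n m"
      using r by (subst koethe_seminorm_finite_support[of "{n}"]) (simp_all add: x_def unit_seq_def)
    also have "\<dots> < \<epsilon>"
      using \<epsilon>(1) apos[of n m] by (simp add: r_def)
    finally have "toeplitz_operator b \<theta> x \<in> ?B"
      using \<epsilon>(2) xK by auto
    then have "koethe_seminorm b k (\<lambda>i. of_real r * toeplitz_column \<theta> n i) < 1"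
      by (simp add: x_def toeplitz_operator_scaled_unit_seq[OF b])
    then have "r * koethe_seminorm b k (toeplitz_column \<theta> n) < 1"
      using r by (simp add: koethe_seminorm_scale toeplitz_column_in_koethe_space)
    then show ?thesis
      using \<epsilon>(1) apos[of n m] by (simp add: r_def field_simps)
  qed
  then show ?thesis
    using \<epsilon>(1) by (intro exI[of _ m] exI[of _ "2 / \<epsilon>"]) simp
qed

text \<open>The seminorms of the source are weighted \<open>l\<^sup>1\<close>-norms, so a bound of the columns by the
  weights makes the series of the terms \<open>x n\<close> times column \<open>n\<close> absolutely convergent, and
  the seminorm of its sum is at most a constant times a seminorm of \<open>x\<close>.\<close>

lemma toeplitz_continuous_if_column_bound:
  fixes \<theta> :: "nat \<Rightarrow> 'a::{real_normed_field,banach}"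
  assumes a: "koethe_matrix a" and b: "koethe_matrix b"
    and bound: "\<And>k. \<exists>m C. \<forall>n. koethe_seminorm b k (toeplitz_column \<theta> n) \<le> C * a n m"
  shows "\<And>x. x \<in> koethe_space a \<Longrightarrow> \<exists>y. toeplitz_sums b \<theta> x y"
    and "continuous_map (koethe_topology a) (koethe_topology b) (toeplitz_operator b \<theta>)"
proof -
  define v where "v x n = (\<lambda>i. x n * toeplitz_column \<theta> n i)" for x n
  have v: "v x n \<in> koethe_space b" for x n
    unfolding v_def by (intro koethe_space_scale toeplitz_column_in_koethe_space)
  have norm_v: "koethe_seminorm b k (v x n) = norm (x n) * koethe_seminorm b k (toeplitz_column \<theta> n)" for k x n
    unfolding v_def by (intro koethe_seminorm_scale toeplitz_column_in_koethe_space)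
  have v_le: "koethe_seminorm b k (v x n) \<le> C * (norm (x n) * a n m)"
    if "\<forall>n. koethe_seminorm b k (toeplitz_column \<theta> n) \<le> C * a n m" for k x n C m
    using mult_left_mono[OF that[rule_format, of n] norm_ge_zero, of "x n"]
    by (simp add: norm_v mult.left_commute)
  have v_nonneg: "0 \<le> koethe_seminorm b k (v x n)" for k x n
    unfolding norm_v koethe_seminorm_toeplitz_column
    by (intro mult_nonneg_nonneg sum_nonneg) (auto simp: koethe_matrix_nonneg b)
  have sum: "summable (\<lambda>n. koethe_seminorm b k (v x n))" if "x \<in> koethe_space a" for x k
  proof -
    obtain m C where mC: "\<forall>n. koethe_seminorm b k (toeplitz_column \<theta> n) \<le> C * a n m"
      using bound by blast
    show ?thesis
      by (rule summable_comparison_test'[OF summable_mult[OF koethe_spaceD[OF that, of m], of C]])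
        (use v_le[OF mC] v_nonneg in simp)
  qed
  have lim: "toeplitz_sums b \<theta> x (\<lambda>i. \<Sum>n. v x n i)" if "x \<in> koethe_space a" for x
    using koethe_series_limit[OF b v sum[OF that]] by (simp add: toeplitz_sums_def v_def)
  then show "\<And>x. x \<in> koethe_space a \<Longrightarrow> \<exists>y. toeplitz_sums b \<theta> x y"
    by blast
  have T: "toeplitz_operator b \<theta> x = (\<lambda>i. \<Sum>n. v x n i)" if "x \<in> koethe_space a" for x
    by (intro toeplitz_operator_eqI b lim that)
  show "continuous_map (koethe_topology a) (koethe_topology b) (toeplitz_operator b \<theta>)"
  proof (rule continuous_map_koethe_topologyI[OF a b])
    show "toeplitz_operator b \<theta> x \<in> koethe_space b" if "x \<in> koethe_space a" for x
      unfolding T[OF that] by (rule koethe_suminf[OF b v sum[OF that]])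
    fix k
    obtain m C where mC: "\<forall>n. koethe_seminorm b k (toeplitz_column \<theta> n) \<le> C * a n m"
      using bound by blast
    have "koethe_seminorm b k (\<lambda>n. toeplitz_operator b \<theta> x n - toeplitz_operator b \<theta> y n)
        \<le> C * koethe_seminorm a m (\<lambda>n. x n - y n)"
      if x: "x \<in> koethe_space a" and y: "y \<in> koethe_space a" for x y
    proof -
      let ?z = "\<lambda>n. x n - y n"
      have z: "?z \<in> koethe_space a"
        by (rule koethe_space_diff[OF a x y])
      have "toeplitz_operator b \<theta> x i - toeplitz_operator b \<theta> y i = (\<Sum>n. v ?z n i)" for i
        using suminf_diff[OF summable_norm_cancel[OF summable_coordinate[OF b v sum[OF x]]]
            summable_norm_cancel[OF summable_coordinate[OF b v sum[OF y]]], of i i]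
        by (simp add: T x y v_def left_diff_distrib)
      then have "koethe_seminorm b k (\<lambda>n. toeplitz_operator b \<theta> x n - toeplitz_operator b \<theta> y n)
          \<le> (\<Sum>n. koethe_seminorm b k (v ?z n))"
        using koethe_suminf(2)[OF b v sum[OF z]] by simp
      also have "\<dots> \<le> (\<Sum>n. C * (norm (?z n) * a n m))"
        by (intro suminf_le v_le[OF mC] sum z summable_mult koethe_spaceD)
      also have "\<dots> = C * koethe_seminorm a m ?z"
        unfolding koethe_seminorm_def by (intro suminf_mult koethe_spaceD z)
      finally show ?thesis .
    qed
    then show "\<exists>m C. \<forall>x\<in>koethe_space a. \<forall>y\<in>koethe_space a.
        koethe_seminorm b k (\<lambda>n. toeplitz_operator b \<theta> x n - toeplitz_operator b \<theta> y n)
        \<le> C * koethe_seminorm a m (\<lambda>n. x n - y n)"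
      by blast
  qed
qed


section \<open>The columns on a nuclear power series space\<close>

text \<open>The terms of the convergent series in the definition of nuclearity decrease, so the sum of the
  series is at least \<open>n + 1\<close> times the term with index \<open>n\<close>.  Therefore \<open>n + 1\<close> grows at most
  like a power of \<open>exp (\<alpha> n)\<close>.\<close>

lemma nuclear_index_growth:
  assumes "exponent_sequence \<alpha>" "nuclear_power_series_space \<alpha>"
  shows "\<exists>q::nat. \<exists>E>0. \<forall>n. real (Suc n) \<le> E * exp (real q * \<alpha> n)"
proof -
  obtain l :: nat where l: "1 < l" and sum: "summable (\<lambda>n. exp ((1 - real l) * \<alpha> n))"
    using assms(2) unfolding nuclear_power_series_space_def by (metis le_refl of_nat_1)
  define q where "q = l - 1"
  have q: "1 - real l = - real q"
    using l by (simp add: q_def of_nat_diff)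
  define E where "E = (\<Sum>n. exp (- real q * \<alpha> n))"
  have sum': "summable (\<lambda>n. exp (- real q * \<alpha> n))"
    using sum unfolding q .
  have "real (Suc n) \<le> E * exp (real q * \<alpha> n)" for n
  proof -
    have "real (Suc n) * exp (- real q * \<alpha> n) = (\<Sum>i\<le>n. exp (- real q * \<alpha> n))"
      by simp
    also have "\<dots> \<le> (\<Sum>i\<le>n. exp (- real q * \<alpha> i))"
      using assms(1) by (intro sum_mono) (auto simp: exponent_sequence_def incseq_def intro!: mult_left_mono)
    also have "\<dots> \<le> E"
      unfolding E_def by (intro sum_le_suminf sum') auto
    finally show ?thesis
      by (simp add: exp_minus field_simps)
  qed
  moreover have "E > 0"
    unfolding E_def by (intro suminf_pos sum') auto
  ultimately show ?thesis by blast
qed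

text \<open>A column has at most \<open>n + 1\<close> non-zero entries; each contributes at most a constant times
  \<open>exp ((p + m) * \<alpha> n)\<close>, and their number is absorbed by \<open>nuclear_index_growth\<close>.  The exponent is
  written as a successor because that is how the power series matrix numbers its columns.\<close>

lemma toeplitz_column_bound:
  fixes \<theta> :: "nat \<Rightarrow> 'a::{real_normed_field,banach}"
  assumes \<alpha>: "exponent_sequence \<alpha>" "nuclear_power_series_space \<alpha>"
    and dual: "\<theta> \<in> power_series_dual \<alpha>"
    and zero: "\<And>t. t < s \<Longrightarrow> \<theta> t = 0"
    and b: "koethe_matrix b"
    and growth: "0 < C" "\<And>n. s \<le> n \<Longrightarrow> b (n - s) k \<le> C * exp (real m * \<alpha> n)"
  shows "\<exists>M B. \<forall>n. koethe_seminorm b k (toeplitz_column \<theta> n) \<le> B * exp (real (Suc M) * \<alpha> n)"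
proof -
  have mono: "\<alpha> i \<le> \<alpha> n" if "i \<le> n" for i n
    using \<alpha>(1) that by (auto simp: exponent_sequence_def incseq_def)
  have nonneg: "0 \<le> \<alpha> n" for n
    using \<alpha>(1) by (auto simp: exponent_sequence_def)
  obtain p D where D: "\<And>t. norm (\<theta> t) * exp (- real p * \<alpha> t) \<le> D"
    using dual by (auto simp: power_series_dual_def bdd_above_def)
  have "0 \<le> norm (\<theta> 0) * exp (- real p * \<alpha> 0)"
    by simp
  then have D0: "0 \<le> D"
    using D[of 0] by linarith
  have \<theta>: "norm (\<theta> t) \<le> D * exp (real p * \<alpha> t)" for t
    using D[of t] by (simp add: exp_minus field_simps)
  obtain q E where E: "E > 0" "\<And>n. real (Suc n) \<le> E * exp (real q * \<alpha> n)"
    using nuclear_index_growth[OF \<alpha>] by blast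
  define M where "M = p + m + q"
  have "koethe_seminorm b k (toeplitz_column \<theta> n) \<le> D * C * E * exp (real (Suc M) * \<alpha> n)" for n
  proof -
    have "norm (\<theta> (n - i)) * b i k \<le> D * C * exp (real (p + m) * \<alpha> n)" if i: "i \<le> n" for i
    proof (cases "n - i < s")
      case True
      then show ?thesis
        using zero D0 growth(1) by simp
    next
      \<comment> \<open>Here \<open>i + s \<le> n\<close>, so the bound of \<open>b i k\<close> in terms of \<open>\<alpha> (i + s)\<close>
        implies one in terms of \<open>\<alpha> n\<close>.\<close>
      case False
      have "b i k \<le> C * exp (real m * \<alpha> (i + s))"
        using growth(2)[of "i + s"] by simp
      also have "\<dots> \<le> C * exp (real m * \<alpha> n)"
        using False i growth(1) mono[of "i + s" n] by (simp add: mult_left_mono)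
      finally have 1: "b i k \<le> C * exp (real m * \<alpha> n)" .
      have "norm (\<theta> (n - i)) \<le> D * exp (real p * \<alpha> (n - i))"
        by (rule \<theta>)
      also have "\<dots> \<le> D * exp (real p * \<alpha> n)"
        using D0 mono[of "n - i" n] by (simp add: mult_left_mono)
      finally have "norm (\<theta> (n - i)) * b i k \<le> (D * exp (real p * \<alpha> n)) * (C * exp (real m * \<alpha> n))"
        using 1 D0 by (intro mult_mono) (auto simp: koethe_matrix_nonneg b)
      also have "\<dots> = D * C * exp (real (p + m) * \<alpha> n)"
        by (simp add: exp_add distrib_right)
      finally show ?thesis .
    qed
    then have "koethe_seminorm b k (toeplitz_column \<theta> n) \<le> (\<Sum>i\<le>n. D * C * exp (real (p + m) * \<alpha> n))"
      unfolding koethe_seminorm_toeplitz_column by (intro sum_mono) simp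
    also have "\<dots> = real (Suc n) * (D * C * exp (real (p + m) * \<alpha> n))"
      by simp
    also have "\<dots> \<le> (E * exp (real q * \<alpha> n)) * (D * C * exp (real (p + m) * \<alpha> n))"
      using D0 growth(1) by (intro mult_right_mono E(2)) simp
    also have "\<dots> = D * C * E * exp (real M * \<alpha> n)"
      by (simp add: M_def exp_add distrib_right)
    also have "\<dots> \<le> D * C * E * exp (real (Suc M) * \<alpha> n)"
      using D0 growth(1) E(1) nonneg by (intro mult_left_mono) (auto simp: distrib_right)
    finally show ?thesis .
  qed
  then show ?thesis by blast
qed

theorem theorem4p3:
  fixes \<alpha> :: "nat \<Rightarrow> real"
    and b :: "nat \<Rightarrow> nat \<Rightarrow> real"
    and \<theta> :: "nat \<Rightarrow> 'a::{real_normed_field,banach}"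
    and s\<^sub>0 :: nat
  assumes "exponent_sequence \<alpha>"
    and "nuclear_power_series_space \<alpha>"
    and "koethe_matrix b"
    and "infinite {t. \<theta> t \<noteq> 0}"
    and "s\<^sub>0 = (LEAST t. \<theta> t \<noteq> 0)"
  shows "toeplitz_well_defined \<alpha> b \<theta> \<and>
      continuous_map (koethe_topology (power_series_matrix \<alpha>)) (koethe_topology b)
        (toeplitz_operator b \<theta>)
    \<longleftrightarrow>
      \<theta> \<in> power_series_dual \<alpha> \<and>
      (\<forall>k. \<exists>m::nat. \<exists>C::real. 1 \<le> m \<and> 0 < C \<and>
         (\<forall>n\<ge>s\<^sub>0. b (n - s\<^sub>0) k \<le> C * exp (real m * \<alpha> n)))"
proof -
  have "0 \<le> \<alpha> n" for n
    using assms(1) by (simp add: exponent_sequence_def)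
  then have a: "koethe_matrix (power_series_matrix \<alpha>)"
    by (rule koethe_matrix_power_series_matrix)
  note b = assms(3)
  have \<theta>0: "\<theta> s\<^sub>0 \<noteq> 0"
    using assms(4) LeastI_ex[of "\<lambda>t. \<theta> t \<noteq> 0"] not_finite_existsD unfolding assms(5) by blast
  have zero: "\<theta> t = 0" if "t < s\<^sub>0" for t
    using that not_less_Least unfolding assms(5) by blast
  show ?thesis
  proof (intro iffI; elim conjE)
    assume cont: "continuous_map (koethe_topology (power_series_matrix \<alpha>)) (koethe_topology b)
        (toeplitz_operator b \<theta>)"
    \<comment> \<open>Each summand of a column seminorm is at most the whole; the indexing by \<open>t\<close> fixes the
      entry of \<open>\<theta>\<close>, so that \<open>t = n\<close> and \<open>t = s\<^sub>0\<close> give the two conditions.\<close>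
    have entry: "\<exists>m. \<exists>C>0. 1 \<le> m \<and> (\<forall>n. \<forall>t\<le>n. norm (\<theta> t) * b (n - t) k \<le> C * exp (real m * \<alpha> n))" for k
    proof -
      obtain m C where C: "C > 0" "\<And>n. koethe_seminorm b k (toeplitz_column \<theta> n) \<le> C * exp (real (Suc m) * \<alpha> n)"
        using toeplitz_column_bound_if_continuous[OF a _ b cont, of k]
        by (auto simp: power_series_matrix_def)
      have "norm (\<theta> t) * b (n - t) k \<le> C * exp (real (Suc m) * \<alpha> n)" if "t \<le> n" for n t
        using coordinate_le_koethe_seminorm[OF b toeplitz_column_in_koethe_space, of \<theta> n "n - t" k] C(2)[of n] that
        by (simp add: toeplitz_column_eq)
      then show ?thesis
        using C(1) by (intro exI[of _ "Suc m"] exI[of _ C]) simp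
    qed
    show "\<theta> \<in> power_series_dual \<alpha> \<and>
      (\<forall>k. \<exists>m::nat. \<exists>C::real. 1 \<le> m \<and> 0 < C \<and>
         (\<forall>n\<ge>s\<^sub>0. b (n - s\<^sub>0) k \<le> C * exp (real m * \<alpha> n)))"
    proof (intro conjI allI)
      \<comment> \<open>The first row of the Toeplitz matrix is \<open>\<theta>\<close> itself.\<close>
      obtain k where k: "0 < b 0 k"
        using b unfolding koethe_matrix_def by blast
      obtain m C where C: "1 \<le> m" "\<And>n t. t \<le> n \<Longrightarrow> norm (\<theta> t) * b (n - t) k \<le> C * exp (real m * \<alpha> n)"
        using entry[of k] by blast
      have "norm (\<theta> n) * exp (- real m * \<alpha> n) \<le> C / b 0 k" for n
        using C(2)[of n n] k by (simp add: exp_minus field_simps)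
      then show "\<theta> \<in> power_series_dual \<alpha>"
        unfolding power_series_dual_def using C(1) by (auto simp: bdd_above_def)
    next
      fix k
      obtain m C where C: "0 < C" "1 \<le> m" "\<And>n t. t \<le> n \<Longrightarrow> norm (\<theta> t) * b (n - t) k \<le> C * exp (real m * \<alpha> n)"
        using entry[of k] by blast
      have "b (n - s\<^sub>0) k \<le> C / norm (\<theta> s\<^sub>0) * exp (real m * \<alpha> n)" if "n \<ge> s\<^sub>0" for n
        using C(3)[OF that] \<theta>0 by (simp add: field_simps)
      then show "\<exists>m::nat. \<exists>C::real. 1 \<le> m \<and> 0 < C \<and>
         (\<forall>n\<ge>s\<^sub>0. b (n - s\<^sub>0) k \<le> C * exp (real m * \<alpha> n))"
        using C(1,2) \<theta>0 by (intro exI[of _ m] exI[of _ "C / norm (\<theta> s\<^sub>0)"]) simp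
    qed
  next
    assume dual: "\<theta> \<in> power_series_dual \<alpha>"
      and growth: "\<forall>k. \<exists>m::nat. \<exists>C::real. 1 \<le> m \<and> 0 < C \<and>
         (\<forall>n\<ge>s\<^sub>0. b (n - s\<^sub>0) k \<le> C * exp (real m * \<alpha> n))"
    have "\<exists>m C. \<forall>n. koethe_seminorm b k (toeplitz_column \<theta> n) \<le> C * power_series_matrix \<alpha> n m" for k
    proof -
      obtain m C where "0 < C" "\<And>n. s\<^sub>0 \<le> n \<Longrightarrow> b (n - s\<^sub>0) k \<le> C * exp (real m * \<alpha> n)"
        using growth by blast
      then show ?thesis
        unfolding power_series_matrix_def
        using toeplitz_column_bound[OF assms(1,2) dual zero b] by blast
    qed
    from toeplitz_continuous_if_column_bound[OF a b this]
    show "toeplitz_well_defined \<alpha> b \<theta> \<and>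
      continuous_map (koethe_topology (power_series_matrix \<alpha>)) (koethe_topology b)
        (toeplitz_operator b \<theta>)"
      unfolding toeplitz_well_defined_def by blast
  qed
qed

end
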